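(* Let $(X,d)$ be a doubling $L$-biLipschitz homogeneous metric space, and let $\mu$ be a Haar-like measure on $X$. Then, for any $t>0$, there exist $r_0>0$ and $K>1$ such that, for all $p\in X$ and any $0<r<r_0$, $$\frac1K\,r^{\dim_{A}(X,d)+t}<\mu(B(p,r))<K\,r^{\dim_{H}(X,d)-t},$$ where $\dim_A$ denotes the Assouad dimension and $\dim_H$ the Hausdorff dimension.
   Context: A metric space is doubling if there is a constant $N\in\mathbb{N}$ such that each ball $B(x,2R)$ is contained in the union of at most $N$ balls of radius $R$. An $L$-biLipschitz map $f:X\to X$ is a homeomorphism of $X$ onto itself with $\frac1L d(x,y)\le d(f(x),f(y))\le L\,d(x,y)$ for all $x,y\in X$. The space is $L$-biLipschitz homogeneous if for every $p,q\in X$ there is an $L$-biLipschitz map $f:X\to X$ with $f(p)=q$. For $\alpha>0$ and Borel measures $\mu,\nu$, write $\mu\stackrel{\alpha}{\approx}\nu$ if $\frac1\alpha\nu(A)\le\mu(A)\le\alpha\,\nu(A)$ for all Borel sets $A$; and $(f_*\mu)(A)=\mu(f^{-1}(A))$. A Haar-like measure on $X$ is a non-zero Radon measure $\mu$ such that for any $L'>1$ there is a positive number $\alpha=\alpha_{L'}$ with $\mu\stackrel{\alpha}{\approx}f_*\mu$ for all $L'$-biLipschitz maps $f:X\to X$. The Assouad dimension is the infimum of all numbers $D>0$ for which there is a constant $C\ge1$ such that, for every $0<\epsilon<1$, every ball of radius $r>0$ contains at most $C\epsilon^{-D}$ distinct points of mutual distance at least $\epsilon r$. *)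

theory Defs
  imports "HOL-Analysis.Analysis"
begin

text \<open>The metric space \<open>(X, d)\<close> is a type of class \<open>metric_space\<close>, with \<open>d = dist\<close>
  and \<open>B(x, r) = ball x r\<close> (open balls).\<close>

definition doubling :: "'a::metric_space itself \<Rightarrow> bool" where
  "doubling _ \<longleftrightarrow> (\<exists>N::nat. \<forall>(x::'a) R. R > 0 \<longrightarrow>
     (\<exists>C. finite C \<and> card C \<le> N \<and> ball x (2 * R) \<subseteq> (\<Union>c\<in>C. ball c R)))"

definition biLipschitz :: "real \<Rightarrow> ('a::metric_space \<Rightarrow> 'a) \<Rightarrow> bool" where
  "biLipschitz L f \<longleftrightarrow> (\<exists>g. homeomorphism UNIV UNIV f g) \<and>
     (\<forall>x y. 1 / L * dist x y \<le> dist (f x) (f y) \<and> dist (f x) (f y) \<le> L * dist x y)"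

definition biLipschitz_homogeneous :: "real \<Rightarrow> 'a::metric_space itself \<Rightarrow> bool" where
  "biLipschitz_homogeneous L _ \<longleftrightarrow> (\<forall>p q::'a. \<exists>f. biLipschitz L f \<and> f p = q)"

definition comparable_measures :: "real \<Rightarrow> 'a::topological_space measure \<Rightarrow> 'a measure \<Rightarrow> bool" where
  "comparable_measures \<alpha> \<mu> \<nu> \<longleftrightarrow> (\<forall>A\<in>sets borel.
     ennreal (1 / \<alpha>) * emeasure \<nu> A \<le> emeasure \<mu> A \<and>
     emeasure \<mu> A \<le> ennreal \<alpha> * emeasure \<nu> A)"

text \<open>Outer regularity at points, together with finiteness on compact sets, makes a Radon measure
  in this sense locally finite, whether or not the space is locally compact.\<close>

definition Radon_measure :: "'a::topological_space measure \<Rightarrow> bool" where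
  "Radon_measure \<mu> \<longleftrightarrow> sets \<mu> = sets borel \<and>
     (\<forall>K. compact K \<longrightarrow> emeasure \<mu> K < \<infinity>) \<and>
     (\<forall>A\<in>sets borel. emeasure \<mu> A = (INF U\<in>{U. open U \<and> A \<subseteq> U}. emeasure \<mu> U)) \<and>
     (\<forall>U. open U \<longrightarrow> emeasure \<mu> U = (SUP K\<in>{K. compact K \<and> K \<subseteq> U}. emeasure \<mu> K))"

definition Haar_like :: "'a::metric_space measure \<Rightarrow> bool" where
  "Haar_like \<mu> \<longleftrightarrow> Radon_measure \<mu> \<and> emeasure \<mu> UNIV \<noteq> 0 \<and>
     (\<forall>L'>1. \<exists>\<alpha>>0. \<forall>f. biLipschitz L' f \<longrightarrow> comparable_measures \<alpha> \<mu> (distr \<mu> borel f))"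

text \<open>Both dimensions take values in \<^typ>\<open>ennreal\<close>, so that an infimum over the empty set is
  \<open>\<infinity>\<close>; on a doubling space both are finite.\<close>

definition Assouad_dim :: "'a::metric_space itself \<Rightarrow> ennreal" where
  "Assouad_dim _ = Inf {ennreal D | D. D > 0 \<and>
     (\<exists>C\<ge>1. \<forall>\<epsilon>. 0 < \<epsilon> \<and> \<epsilon> < 1 \<longrightarrow> (\<forall>(x::'a) r. r > 0 \<longrightarrow>
        (\<forall>S. S \<subseteq> ball x r \<and> pairwise (\<lambda>y z. dist y z \<ge> \<epsilon> * r) S \<longrightarrow>
           finite S \<and> real (card S) \<le> C * \<epsilon> powr (- D))))}"

text \<open>\<open>(diam U)\<^sup>s\<close> with the usual conventions: the empty set contributes \<open>0\<close>, and
  a nonempty set contributes \<open>1\<close> when \<open>s = 0\<close> (whereas \<open>0 powr 0 = 0\<close> in HOL).\<close>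

definition Hausdorff_gauge :: "real \<Rightarrow> 'a::metric_space set \<Rightarrow> ennreal" where
  "Hausdorff_gauge s U =
     (if U = {} then 0 else if s = 0 then 1 else ennreal (diameter U powr s))"

text \<open>\<^const>\<open>diameter\<close> is real-valued and unspecified on unbounded sets, hence the
  boundedness requirement on the covering sets.\<close>

definition Hausdorff_premeasure :: "real \<Rightarrow> real \<Rightarrow> 'a::metric_space set \<Rightarrow> ennreal" where
  "Hausdorff_premeasure s \<delta> A =
     (INF U\<in>{U :: nat \<Rightarrow> 'a set. A \<subseteq> (\<Union>i. U i) \<and>
               (\<forall>i. bounded (U i) \<and> diameter (U i) \<le> \<delta>)}. (\<Sum>i. Hausdorff_gauge s (U i)))"

definition Hausdorff_measure :: "real \<Rightarrow> 'a::metric_space set \<Rightarrow> ennreal" where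
  "Hausdorff_measure s A = (SUP \<delta>\<in>{0<..}. Hausdorff_premeasure s \<delta> A)"

definition Hausdorff_dim :: "'a::metric_space set \<Rightarrow> ennreal" where
  "Hausdorff_dim A = Inf {ennreal s | s. s \<ge> 0 \<and> Hausdorff_measure s A = 0}"

end

theory Submission imports Defs begin

text \<open>
  Homogeneity and the Haar-like property give \<open>\<mu>(B(p,r)) \<le> \<alpha> \<mu>(B(q,L'r))\<close> for all \<open>p\<close>, \<open>q\<close>, \<open>r\<close>, so
  balls of one radius have comparable measure up to a dilation of the radius.

  Lower bound: a ball of radius 1 is covered by at most \<open>C r\<^sup>-\<^sup>D\<close> balls of radius \<open>r\<close> with
  \<open>D \<le> dim\<^sub>A + t\<close>, and its measure is positive, so each of the small balls has measure at least a
  multiple of \<open>r\<^sup>D\<close>.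

  Upper bound: let \<open>s = dim\<^sub>H - t > 0\<close>. If \<open>\<mu>(B(p,r)) > K r\<^sup>s\<close> occurs for arbitrarily large \<open>K\<close>, then
  \<open>r\<close> must be small, and since the disjoint balls of radius \<open>L'r\<close> inside a ball of finite measure are
  at most \<open>const / (K r\<^sup>s)\<close> many, doubling their radii gives covers whose \<open>s\<close>-gauge sums tend to 0.
  Hence the space is \<open>s\<close>-null, contradicting \<open>s < dim\<^sub>H\<close>.
\<close>

section \<open>Packing and covering in doubling spaces\<close>

text \<open>Iterates the doubling condition: each halving of the radius replaces every ball by at
  most \<open>N\<close> smaller ones. The bound \<open>N \<ge> 2\<close> makes
  \<open>log 2 N\<close> positive, so that it can serve as an exponent below.\<close>

lemma doubling_covers:
  assumes "doubling TYPE('a::metric_space)"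
  obtains N :: nat where "N \<ge> 2"
    "\<And>k (x::'a) R. R > 0 \<Longrightarrow>
       \<exists>C. finite C \<and> card C \<le> N ^ k \<and> ball x (2 ^ k * R) \<subseteq> (\<Union>c\<in>C. ball c R)"
proof -
  obtain N0 :: nat where N0: "\<And>(x::'a) R. R > 0 \<Longrightarrow>
      \<exists>C. finite C \<and> card C \<le> N0 \<and> ball x (2 * R) \<subseteq> (\<Union>c\<in>C. ball c R)"
    using assms unfolding doubling_def by blast
  define N where "N = max 2 N0"
  have "\<exists>C. finite C \<and> card C \<le> N ^ k \<and> ball x (2 ^ k * R) \<subseteq> (\<Union>c\<in>C. ball c R)"
    if "R > 0" for k and x :: 'a and R
  proof (induction k arbitrary: x)
    case 0
    show ?case by (intro exI[of _ "{x}"]) auto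
  next
    case (Suc k)
    obtain C where C: "finite C" "card C \<le> N0" "ball x (2 * (2 ^ k * R)) \<subseteq> (\<Union>c\<in>C. ball c (2 ^ k * R))"
      using N0[of "2 ^ k * R" x] \<open>R > 0\<close> by auto
    from Suc obtain D where D: "\<And>c::'a. finite (D c) \<and> card (D c) \<le> N ^ k \<and>
        ball c (2 ^ k * R) \<subseteq> (\<Union>d\<in>D c. ball d R)"
      by metis
    have "card (\<Union>c\<in>C. D c) \<le> (\<Sum>c\<in>C. card (D c))"
      by (rule card_UN_le[OF C(1)])
    also have "\<dots> \<le> (\<Sum>c\<in>C. N ^ k)"
      using D by (intro sum_mono) blast
    also have "\<dots> \<le> N ^ Suc k"
      using C(2) by (simp add: N_def le_max_iff_disj)
    finally have "card (\<Union>c\<in>C. D c) \<le> N ^ Suc k" .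
    moreover have "ball x (2 ^ Suc k * R) \<subseteq> (\<Union>d\<in>(\<Union>c\<in>C. D c). ball d R)"
    proof -
      have "ball x (2 ^ Suc k * R) = ball x (2 * (2 ^ k * R))"
        by (simp add: mult.assoc)
      also have "\<dots> \<subseteq> (\<Union>c\<in>C. ball c (2 ^ k * R))"
        by (rule C(3))
      also have "\<dots> \<subseteq> (\<Union>c\<in>C. \<Union>d\<in>D c. ball d R)"
        using D by (intro UN_mono) simp_all
      finally show ?thesis by simp
    qed
    moreover have "finite (\<Union>c\<in>C. D c)"
      using C(1) D by blast
    ultimately show ?case by blast
  qed
  moreover have "N \<ge> 2" by (simp add: N_def)
  ultimately show thesis using that by blast
qed

text \<open>Pigeonhole: two points in one open ball of radius \<open>R\<close> are closer than
  \<open>2 * R\<close>, so sending each point of \<open>S\<close> to the centre of a ball containing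
  it is injective.\<close>

lemma card_separated_le_card_cover:
  assumes "finite C" "S \<subseteq> (\<Union>c\<in>C. ball c R)" "pairwise (\<lambda>y z. dist y z \<ge> 2 * R) S"
  shows "finite S \<and> card S \<le> card C"
proof -
  have "\<forall>s\<in>S. \<exists>c\<in>C. s \<in> ball c R"
    using assms(2) by blast
  then obtain g where g: "\<And>s. s \<in> S \<Longrightarrow> g s \<in> C \<and> s \<in> ball (g s) R"
    by metis
  have "inj_on g S"
  proof (rule inj_onI, rule ccontr)
    fix y z assume yz: "y \<in> S" "z \<in> S" "g y = g z" "y \<noteq> z"
    have "dist y z \<le> dist (g y) y + dist (g y) z"
      by (rule dist_triangle3)
    also have "\<dots> < 2 * R"
      using g[OF yz(1)] g[OF yz(2)] yz(3) by simp
    finally show False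
      using pairwiseD[OF assms(3) yz(1,2,4)] by simp
  qed
  moreover have "g ` S \<subseteq> C" using g by blast
  ultimately show ?thesis
    using assms(1) by (meson card_inj_on_le inj_on_finite)
qed

text \<open>The exponent \<open>log 2 N\<close> is admissible. Finiteness ensures that
  \<open>enn2real\<close> loses nothing on the Assouad dimension.\<close>

lemma Assouad_dim_finite:
  assumes "doubling TYPE('a::metric_space)"
  shows "Assouad_dim TYPE('a) < \<infinity>"
proof -
  obtain N :: nat where N: "N \<ge> 2" "\<And>k (x::'a) R. R > 0 \<Longrightarrow>
       \<exists>C. finite C \<and> card C \<le> N ^ k \<and> ball x (2 ^ k * R) \<subseteq> (\<Union>c\<in>C. ball c R)"
    using doubling_covers[OF assms] by blast
  define D where "D = log 2 N"
  have D: "D > 0" using N(1) by (simp add: D_def)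
  have N_powr: "real N powr z = 2 powr (D * z)" for z
    using N(1) by (simp add: D_def powr_powr[symmetric])
  have "finite S \<and> real (card S) \<le> real N ^ 2 * \<epsilon> powr (- D)"
    if \<epsilon>: "0 < \<epsilon>" "\<epsilon> < 1" and "r > 0" "S \<subseteq> ball x r" and
      sep: "pairwise (\<lambda>y z. dist y z \<ge> \<epsilon> * r) S" for \<epsilon> r and x :: 'a and S
  proof -
    \<comment> \<open>The least \<open>k\<close> for which \<open>2 ^ k\<close> times half the
      separation \<open>\<epsilon> * r\<close> reaches \<open>r\<close>. Rounding up and the
      numerator 2 cost one factor \<open>N\<close> each, whence the constant
      \<open>N ^ 2\<close>.\<close>
    define k where "k = nat \<lceil>log 2 (2 / \<epsilon>)\<rceil>"
    have log_pos: "log 2 (2 / \<epsilon>) > 0"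
      using \<epsilon> by simp
    have k: "log 2 (2 / \<epsilon>) \<le> k" "k \<le> log 2 (2 / \<epsilon>) + 1"
      using log_pos unfolding k_def by linarith+
    have "2 / \<epsilon> = 2 powr log 2 (2 / \<epsilon>)"
      using \<epsilon> by simp
    also have "\<dots> \<le> 2 powr k"
      using k(1) by (intro powr_mono) auto
    finally have "2 / \<epsilon> \<le> 2 ^ k"
      by (simp add: powr_realpow)
    then have "r \<le> 2 ^ k * (\<epsilon> * r / 2)"
      using \<epsilon> \<open>r > 0\<close> by (simp add: field_simps)
    then have "S \<subseteq> ball x (2 ^ k * (\<epsilon> * r / 2))"
      using \<open>S \<subseteq> ball x r\<close> by (meson order_trans subset_ball)
    then obtain C where C: "finite C" "card C \<le> N ^ k" "S \<subseteq> (\<Union>c\<in>C. ball c (\<epsilon> * r / 2))"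
      using N(2)[of "\<epsilon> * r / 2" k x] \<epsilon> \<open>r > 0\<close> by auto
    have S: "finite S" "card S \<le> card C"
      using card_separated_le_card_cover[OF C(1,3)] sep by auto
    have "real (card S) \<le> real (N ^ k)"
      using S(2) C(2) by (simp only: of_nat_le_iff)
    also have "\<dots> = real N powr k"
      using N(1) by (simp add: powr_realpow)
    also have "\<dots> \<le> real N powr (log 2 (2 / \<epsilon>) + 1)"
      using N(1) k(2) by (intro powr_mono) auto
    also have "\<dots> = real N powr (2 - log 2 \<epsilon>)"
      using \<epsilon> by (simp add: log_divide)
    also have "\<dots> = real N powr 2 / real N powr (log 2 \<epsilon>)"
      by (rule powr_diff)
    also have "real N powr (log 2 \<epsilon>) = \<epsilon> powr D"
      using \<epsilon> by (simp add: N_powr mult.commute[of D] powr_powr[symmetric])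
    also have "real N powr 2 = real N ^ 2"
      using N(1) by simp
    finally show ?thesis
      using S(1) by (simp add: powr_minus divide_inverse)
  qed
  moreover have "real N ^ 2 \<ge> 1"
    using N(1) by simp
  ultimately have "Assouad_dim TYPE('a) \<le> ennreal D"
    unfolding Assouad_dim_def using D by (intro Inf_lower) blast
  then show ?thesis
    by (rule order.strict_trans1) simp
qed

text \<open>The infimum need not be an admissible exponent itself, but any bound strictly above it
  leaves room for one.\<close>

lemma Assouad_dim_lessE:
  assumes "Assouad_dim TYPE('a::metric_space) < d"
  obtains D C where "D > 0" "ennreal D < d" "C \<ge> 1"
    "\<And>\<epsilon> (x::'a) r S. 0 < \<epsilon> \<Longrightarrow> \<epsilon> < 1 \<Longrightarrow> r > 0 \<Longrightarrow> S \<subseteq> ball x r \<Longrightarrow>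
      pairwise (\<lambda>y z. dist y z \<ge> \<epsilon> * r) S \<Longrightarrow> finite S \<and> real (card S) \<le> C * \<epsilon> powr (- D)"
  using assms unfolding Assouad_dim_def Inf_less_iff
  by (elim bexE CollectE exE conjE) (rule that, auto)

text \<open>A separated set of maximal cardinality covers the ball, since an uncovered point could
  be added to it. Doubling bounds the cardinalities of separated sets, so a maximum exists.\<close>

lemma doubling_net:
  assumes "doubling TYPE('a::metric_space)" "R > 0" "e > 0"
  obtains S where "finite S" "S \<subseteq> ball x R" "pairwise (\<lambda>y z. dist y z \<ge> e) S"
    "ball (x::'a) R \<subseteq> (\<Union>s\<in>S. ball s e)"
proof -
  obtain N :: nat where N: "N \<ge> 2" "\<And>k (x::'a) R. R > 0 \<Longrightarrow>
       \<exists>C. finite C \<and> card C \<le> N ^ k \<and> ball x (2 ^ k * R) \<subseteq> (\<Union>c\<in>C. ball c R)"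
    using doubling_covers[OF assms(1)] by blast
  obtain k :: nat where "2 * R / e < 2 ^ k"
    using real_arch_pow[of 2 "2 * R / e"] by auto
  then have "R \<le> 2 ^ k * (e / 2)"
    using assms by (simp add: field_simps)
  then have "ball x R \<subseteq> ball x (2 ^ k * (e / 2))"
    by (rule subset_ball)
  then obtain C where C: "finite C" "ball x R \<subseteq> (\<Union>c\<in>C. ball c (e / 2))"
    using N(2)[of "e / 2" k x] \<open>e > 0\<close> by auto
  define P where "P S \<longleftrightarrow> S \<subseteq> ball x R \<and> pairwise (\<lambda>y z. dist y z \<ge> e) S" for S
  have bound: "finite S \<and> card S \<le> card C" if "P S" for S
    using card_separated_le_card_cover[OF C(1), of S "e / 2"] C(2) that by (auto simp: P_def)
  have "P {}" by (simp add: P_def)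
  then have "\<exists>S. P S \<and> (\<forall>T. P T \<longrightarrow> card T \<le> card S)"
    using bound by (intro ex_has_greatest_nat[of P _ card "Suc (card C)"]) (auto simp: less_Suc_eq_le)
  then obtain S where S: "P S" "\<And>T. P T \<Longrightarrow> card T \<le> card S"
    by blast
  have "ball x R \<subseteq> (\<Union>s\<in>S. ball s e)"
  proof (rule ccontr)
    assume "\<not> ?thesis"
    then obtain y where y: "y \<in> ball x R" "\<And>s. s \<in> S \<Longrightarrow> dist s y \<ge> e"
      by force
    then have "y \<notin> S" using \<open>e > 0\<close> by force
    have "P (insert y S)"
      using S(1) y by (auto simp: P_def pairwise_insert dist_commute)
    then show False
      using S(2)[of "insert y S"] bound[OF S(1)] \<open>y \<notin> S\<close> by simp
  qed
  then show thesis
    using that S(1) bound[OF S(1)] by (auto simp: P_def)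
qed

text \<open>The balls of integer radius about one point exhaust the space, and each of them has a
  finite net.\<close>

lemma doubling_countable_net:
  assumes "doubling TYPE('a::metric_space)" "e > 0"
  obtains q :: "nat \<Rightarrow> 'a::metric_space" where "(\<Union>i. ball (q i) e) = UNIV"
proof -
  fix x :: 'a
  have "\<exists>S. finite S \<and> ball x (real (Suc n)) \<subseteq> (\<Union>s\<in>S. ball s e)" for n
    using doubling_net[OF assms(1) _ assms(2), of "real (Suc n)" x]
    by (metis of_nat_0_less_iff zero_less_Suc)
  then obtain S where S: "\<And>n. finite (S n) \<and> ball x (real (Suc n)) \<subseteq> (\<Union>s\<in>S n. ball s e)"
    by metis
  define Q where "Q = (\<Union>n. S n)"
  have cover: "(\<Union>s\<in>Q. ball s e) = UNIV"
  proof -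
    have "y \<in> (\<Union>s\<in>Q. ball s e)" for y
    proof -
      obtain n where "dist x y < real n"
        using reals_Archimedean2 by blast
      then have "y \<in> ball x (real (Suc n))" by simp
      then show ?thesis
        using S[of n] unfolding Q_def by blast
    qed
    then show ?thesis by blast
  qed
  have "countable Q"
    using S by (auto simp: Q_def intro: countable_finite)
  \<comment> \<open>The range of \<open>from_nat_into Q\<close> equals \<open>Q\<close> only if
    \<open>Q\<close> is nonempty.\<close>
  moreover have "Q \<noteq> {}"
    using cover by auto
  ultimately have "range (from_nat_into Q) = Q"
    by simp
  moreover have "(\<Union>i. ball (from_nat_into Q i) e) = (\<Union>s\<in>range (from_nat_into Q). ball s e)"
    by blast
  ultimately have "(\<Union>i. ball (from_nat_into Q i) e) = UNIV"
    using cover by simp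
  then show thesis by (rule that)
qed

section \<open>Hausdorff null sets\<close>

lemma diameter_ball_le:
  fixes x :: "'a::metric_space"
  assumes "R \<ge> 0"
  shows "diameter (ball x R) \<le> 2 * R"
proof (cases "ball x R = {}")
  case False
  have "dist y z \<le> 2 * R" if "y \<in> ball x R" "z \<in> ball x R" for y z
    using that dist_triangle3[of y z x] by simp
  then show ?thesis
    using False unfolding diameter_def by (auto intro!: cSUP_least)
qed (use assms in simp)

text \<open>The premeasure is defined with sequences, so the finite cover is padded with empty sets,
  which have gauge 0 for every \<open>s\<close>.\<close>

lemma Hausdorff_premeasure_le_finite_cover:
  assumes "finite C" "A \<subseteq> (\<Union>c\<in>C. V c)" "\<delta> \<ge> 0"
    and V: "\<And>c. c \<in> C \<Longrightarrow> bounded (V c) \<and> diameter (V c) \<le> \<delta>"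
  shows "Hausdorff_premeasure s \<delta> A \<le> (\<Sum>c\<in>C. Hausdorff_gauge s (V c))"
proof -
  obtain h where h: "bij_betw h {0..<card C} C"
    using ex_bij_betw_nat_finite[OF assms(1)] by blast
  define U where "U i = (if i < card C then V (h i) else {})" for i
  have hC: "h i \<in> C" if "i < card C" for i
    using bij_betwE[OF h] that by auto
  have "A \<subseteq> (\<Union>i. U i)"
  proof
    fix a assume "a \<in> A"
    then obtain c where c: "c \<in> C" "a \<in> V c" using assms(2) by blast
    then obtain i where "i < card C" "h i = c"
      using h by (metis atLeastLessThan_iff bij_betw_iff_bijections)
    then have "a \<in> U i" using c by (simp add: U_def)
    then show "a \<in> (\<Union>i. U i)" by blast
  qed
  moreover have "bounded (U i) \<and> diameter (U i) \<le> \<delta>" for i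
    using V hC \<open>\<delta> \<ge> 0\<close> by (auto simp: U_def)
  ultimately have "Hausdorff_premeasure s \<delta> A \<le> (\<Sum>i. Hausdorff_gauge s (U i))"
    unfolding Hausdorff_premeasure_def by (intro INF_lower) blast
  also have "\<dots> = (\<Sum>i\<in>{0..<card C}. Hausdorff_gauge s (U i))"
    by (rule suminf_finite) (auto simp: U_def Hausdorff_gauge_def)
  also have "\<dots> = (\<Sum>i\<in>{0..<card C}. Hausdorff_gauge s (V (h i)))"
    by (rule sum.cong) (auto simp: U_def)
  also have "\<dots> = (\<Sum>c\<in>C. Hausdorff_gauge s (V c))"
    by (rule sum.reindex_bij_betw[OF h])
  finally show ?thesis .
qed

lemma Hausdorff_measure_eq_0I:
  assumes "\<And>\<delta> e. \<delta> > 0 \<Longrightarrow> e > 0 \<Longrightarrow> Hausdorff_premeasure s \<delta> A \<le> ennreal e"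
  shows "Hausdorff_measure s A = 0"
proof -
  have "Hausdorff_premeasure s \<delta> A = 0" if "\<delta> > 0" for \<delta>
    using ennreal_le_epsilon[of 0 "Hausdorff_premeasure s \<delta> A"] assms[OF that] by simp
  then show ?thesis
    unfolding Hausdorff_measure_def by (simp add: bot_ennreal)
qed

text \<open>The usual \<open>e / 2 ^ Suc n\<close> argument: near-optimal covers of the sets
  \<open>A n\<close> are merged into a single sequence through the pairing of natural
  numbers.\<close>

lemma Hausdorff_measure_UN_null:
  fixes A :: "nat \<Rightarrow> 'a::metric_space set"
  assumes "\<And>n. Hausdorff_measure s (A n) = 0"
  shows "Hausdorff_measure s (\<Union>n. A n) = 0"
proof (rule Hausdorff_measure_eq_0I)
  fix \<delta> e :: real
  assume "\<delta> > 0" "e > 0"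
  have "\<exists>U. A n \<subseteq> (\<Union>i. U i) \<and> (\<forall>i. bounded (U i) \<and> diameter (U i) \<le> \<delta>) \<and>
      (\<Sum>i. Hausdorff_gauge s (U i)) \<le> ennreal (e * (1/2) ^ Suc n)" for n
  proof -
    have "Hausdorff_premeasure s \<delta> (A n) \<le> Hausdorff_measure s (A n)"
      unfolding Hausdorff_measure_def using \<open>\<delta> > 0\<close> by (intro SUP_upper) simp
    also have "\<dots> < ennreal (e * (1/2) ^ Suc n)"
      using assms \<open>e > 0\<close> by simp
    finally show ?thesis
      unfolding Hausdorff_premeasure_def INF_less_iff by (auto intro: less_imp_le)
  qed
  then obtain U where U: "\<And>n. A n \<subseteq> (\<Union>i. U n i)"
      "\<And>n i. bounded (U n i) \<and> diameter (U n i) \<le> \<delta>"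
      "\<And>n. (\<Sum>i. Hausdorff_gauge s (U n i)) \<le> ennreal (e * (1/2) ^ Suc n)"
    by metis
  define W where "W j = (case prod_decode j of (n, i) \<Rightarrow> U n i)" for j
  have "(\<Union>n. A n) \<subseteq> (\<Union>j. W j)"
  proof
    fix a assume "a \<in> (\<Union>n. A n)"
    then obtain n i where "a \<in> U n i" using U(1) by blast
    then have "a \<in> W (prod_encode (n, i))" by (simp add: W_def)
    then show "a \<in> (\<Union>j. W j)" by blast
  qed
  moreover have "bounded (W j) \<and> diameter (W j) \<le> \<delta>" for j
    using U(2) by (auto simp: W_def split: prod.split)
  ultimately have "Hausdorff_premeasure s \<delta> (\<Union>n. A n) \<le> (\<Sum>j. Hausdorff_gauge s (W j))"
    unfolding Hausdorff_premeasure_def by (intro INF_lower) blast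
  also have "\<dots> = (\<Sum>j. (\<lambda>(n, i). Hausdorff_gauge s (U n i)) (prod_decode j))"
    by (intro arg_cong[where f=suminf]) (auto simp: W_def fun_eq_iff split: prod.split)
  also have "\<dots> = (\<Sum>n. \<Sum>i. Hausdorff_gauge s (U n i))"
    by (rule suminf_ennreal_2dimen) simp
  also have "\<dots> \<le> (\<Sum>n. ennreal (e * (1/2) ^ Suc n))"
    using U(3) by (intro suminf_le) auto
  also have "\<dots> = ennreal e"
    using \<open>e > 0\<close> sums_mult[OF power_half_series, of e] by (intro suminf_ennreal_eq) auto
  finally show "Hausdorff_premeasure s \<delta> (\<Union>n. A n) \<le> ennreal e" .
qed

section \<open>Haar-like measures\<close>

text \<open>Needed because the Haar-like property speaks of constants above 1 only, whereas the
  homogeneity constant is an arbitrary real.\<close>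

lemma biLipschitz_mono:
  fixes f :: "'a::metric_space \<Rightarrow> 'a"
  assumes "biLipschitz L f" "L \<le> L'" "L' \<ge> 1"
  shows "biLipschitz L' f"
proof -
  obtain g where g: "homeomorphism UNIV UNIV f g"
    using assms(1) unfolding biLipschitz_def by blast
  have lip: "1 / L * dist x y \<le> dist (f x) (f y)" "dist (f x) (f y) \<le> L * dist x y" for x y
    using assms(1) unfolding biLipschitz_def by blast+
  have "1 / L' * dist x y \<le> dist (f x) (f y) \<and> dist (f x) (f y) \<le> L' * dist x y" for x y
  proof (cases "x = y")
    case False
    \<comment> \<open>The sign of \<open>L\<close> is not given. Two distinct points have distinct
      images, and the upper Lipschitz bound then forces \<open>L > 0\<close>.\<close>
    then have "f x \<noteq> f y"
      using g by (metis UNIV_I homeomorphism_apply1)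
    then have "0 < L * dist x y"
      using lip(2)[of x y] by (metis order.strict_trans2 zero_less_dist_iff)
    then have "L > 0"
      using False by (simp add: zero_less_mult_iff)
    then have "1 / L' \<le> 1 / L"
      using assms(2) by (simp add: frac_le)
    then have "1 / L' * dist x y \<le> 1 / L * dist x y"
      by (rule mult_right_mono) simp
    moreover have "L * dist x y \<le> L' * dist x y"
      using assms(2) by (rule mult_right_mono) simp
    ultimately show ?thesis
      using lip[of x y] by linarith
  qed simp
  then show ?thesis
    using g unfolding biLipschitz_def by blast
qed

lemma Haar_likeD:
  assumes "Haar_like \<mu>"
  shows "sets \<mu> = sets borel" and "emeasure \<mu> UNIV \<noteq> 0"
    and "compact K \<Longrightarrow> emeasure \<mu> K < \<infinity>"
    and "A \<in> sets borel \<Longrightarrow> emeasure \<mu> A = (INF U\<in>{U. open U \<and> A \<subseteq> U}. emeasure \<mu> U)"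
    and "open V \<Longrightarrow> emeasure \<mu> V = (SUP K\<in>{K. compact K \<and> K \<subseteq> V}. emeasure \<mu> K)"
proof -
  have radon: "Radon_measure \<mu>" and nonzero: "emeasure \<mu> UNIV \<noteq> 0"
    using assms unfolding Haar_like_def by - (elim conjE, assumption)+
  have regular: "sets \<mu> = sets borel" "\<forall>K. compact K \<longrightarrow> emeasure \<mu> K < \<infinity>"
      "\<forall>A\<in>sets borel. emeasure \<mu> A = (INF U\<in>{U. open U \<and> A \<subseteq> U}. emeasure \<mu> U)"
      "\<forall>V. open V \<longrightarrow> emeasure \<mu> V = (SUP K\<in>{K. compact K \<and> K \<subseteq> V}. emeasure \<mu> K)"
    using radon unfolding Radon_measure_def by - (elim conjE, assumption)+
  show "sets \<mu> = sets borel" "emeasure \<mu> UNIV \<noteq> 0"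
    by (fact regular(1) nonzero)+
  show "emeasure \<mu> K < \<infinity>" if "compact K"
    using regular(2)[rule_format, OF that] .
  show "emeasure \<mu> A = (INF U\<in>{U. open U \<and> A \<subseteq> U}. emeasure \<mu> U)" if "A \<in> sets borel"
    using regular(3) that by (rule bspec)
  show "emeasure \<mu> V = (SUP K\<in>{K. compact K \<and> K \<subseteq> V}. emeasure \<mu> K)" if "open V"
    using regular(4)[rule_format, OF that] .
qed

text \<open>Take a biLipschitz \<open>f\<close> with \<open>f q = p\<close>. The preimage of
  \<open>ball p r\<close> lies in \<open>ball q (L' * r)\<close>, and \<mu> is bounded by \<alpha>
  times its image under \<open>f\<close>. Neither constant depends on the centres or on the
  radius.\<close>

lemma Haar_like_ball_le:
  fixes \<mu> :: "'a::metric_space measure"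
  assumes hom: "biLipschitz_homogeneous L TYPE('a)" and haar: "Haar_like \<mu>"
  obtains L' \<alpha> :: real where "L' > 1" "\<alpha> > 0"
    "\<And>p q r. emeasure \<mu> (ball p r) \<le> ennreal \<alpha> * emeasure \<mu> (ball q (L' * r))"
proof -
  define M where "M = max L 2"
  have M: "M > 1" "L \<le> M" by (auto simp: M_def)
  obtain \<alpha> where \<alpha>: "\<alpha> > 0" "\<And>f. biLipschitz M f \<Longrightarrow> comparable_measures \<alpha> \<mu> (distr \<mu> borel f)"
    using haar M(1) unfolding Haar_like_def by blast
  note sets = Haar_likeD(1)[OF haar]
  have "emeasure \<mu> (ball p r) \<le> ennreal \<alpha> * emeasure \<mu> (ball q (M * r))" for p q r
  proof -
    obtain f where "biLipschitz L f" "f q = p"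
      using hom unfolding biLipschitz_homogeneous_def by blast
    then have f: "biLipschitz M f" using biLipschitz_mono M by fastforce
    then have "continuous_on UNIV f"
      unfolding biLipschitz_def homeomorphism_def by blast
    then have meas: "f \<in> measurable \<mu> borel"
      using sets by (simp add: borel_measurable_continuous_onI cong: measurable_cong_sets)
    have "emeasure \<mu> (ball p r) \<le> ennreal \<alpha> * emeasure (distr \<mu> borel f) (ball p r)"
      using \<alpha>(2)[OF f] unfolding comparable_measures_def by simp
    also have "emeasure (distr \<mu> borel f) (ball p r) = emeasure \<mu> (f -` ball p r \<inter> space \<mu>)"
      using meas by (simp add: emeasure_distr)
    also have "\<dots> \<le> emeasure \<mu> (ball q (M * r))"
    proof (rule emeasure_mono)
      show "f -` ball p r \<inter> space \<mu> \<subseteq> ball q (M * r)"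
      proof
        fix y assume "y \<in> f -` ball p r \<inter> space \<mu>"
        then have "dist (f q) (f y) < r" using \<open>f q = p\<close> by simp
        moreover have "1 / M * dist q y \<le> dist (f q) (f y)"
          using f unfolding biLipschitz_def by blast
        ultimately have "1 / M * dist q y < r"
          by (rule order.strict_trans1[rotated])
        then show "y \<in> ball q (M * r)"
          using M(1) by (simp add: field_simps)
      qed
    qed (simp add: sets)
    finally show ?thesis
      by (simp add: mult_left_mono)
  qed
  then show thesis using that M(1) \<alpha>(1) by blast
qed

text \<open>One null ball makes all balls of a smaller radius null by comparison, hence all compact
  sets by finite covers, hence the whole space by inner regularity.\<close>

lemma Haar_like_ball_pos:
  fixes \<mu> :: "'a::metric_space measure"
  assumes hom: "biLipschitz_homogeneous L TYPE('a)" and haar: "Haar_like \<mu>" and "r > 0"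
  shows "emeasure \<mu> (ball p r) > 0"
proof (rule ccontr)
  assume "\<not> ?thesis"
  then have null_p: "emeasure \<mu> (ball p r) = 0" by simp
  obtain L' \<alpha> :: real where L': "L' > 1" "\<alpha> > 0"
    "\<And>p q r. emeasure \<mu> (ball p r) \<le> ennreal \<alpha> * emeasure \<mu> (ball q (L' * r))"
    using Haar_like_ball_le[OF hom haar] by blast
  define \<rho> where "\<rho> = r / L'"
  have "\<rho> > 0" "L' * \<rho> = r" using L'(1) \<open>r > 0\<close> by (auto simp: \<rho>_def)
  then have null: "emeasure \<mu> (ball q \<rho>) = 0" for q
    using L'(3)[of q \<rho> p] null_p by simp
  note sets = Haar_likeD(1)[OF haar]
  have "emeasure \<mu> K = 0" if "compact K" for K
  proof -
    have cover: "K \<subseteq> (\<Union>c\<in>K. ball c \<rho>)"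
      using \<open>\<rho> > 0\<close> by (auto intro: centre_in_ball[THEN iffD2])
    obtain C where "C \<subseteq> K" and C: "finite C" "K \<subseteq> (\<Union>c\<in>C. ball c \<rho>)"
      by (rule compactE_image[OF \<open>compact K\<close> _ cover]) simp
    have "emeasure \<mu> K \<le> emeasure \<mu> (\<Union>c\<in>C. ball c \<rho>)"
      using C(2) by (intro emeasure_mono) (simp_all add: sets open_UN)
    also have "\<dots> \<le> (\<Sum>c\<in>C. emeasure \<mu> (ball c \<rho>))"
      using C(1) by (intro emeasure_subadditive_finite) (auto simp: sets)
    finally show ?thesis by (simp add: null)
  qed
  then have "(SUP K\<in>{K. compact K \<and> K \<subseteq> UNIV}. emeasure \<mu> K) \<le> 0"
    by (intro SUP_least) simp
  with Haar_likeD(5)[OF haar open_UNIV] have "emeasure \<mu> UNIV \<le> 0"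
    by (rule ord_eq_le_trans)
  then show False
    using Haar_likeD(2)[OF haar] by simp
qed

text \<open>Outer regularity at a singleton, which is compact and so of finite measure, yields one
  ball of finite measure. Comparison carries the bound to all centres at a smaller radius.\<close>

lemma Haar_like_ball_bounded:
  fixes \<mu> :: "'a::metric_space measure"
  assumes hom: "biLipschitz_homogeneous L TYPE('a)" and haar: "Haar_like \<mu>"
  obtains R M :: real where "R > 0" "M > 0" "\<And>q. emeasure \<mu> (ball q R) \<le> ennreal M"
proof -
  obtain L' \<alpha> :: real where L': "L' > 1" "\<alpha> > 0"
    "\<And>p q r. emeasure \<mu> (ball p r) \<le> ennreal \<alpha> * emeasure \<mu> (ball q (L' * r))"
    using Haar_like_ball_le[OF hom haar] by blast
  fix p :: 'a
  note sets = Haar_likeD(1)[OF haar]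
  have "(INF U\<in>{U. open U \<and> {p} \<subseteq> U}. emeasure \<mu> U) < \<infinity>"
    by (subst Haar_likeD(4)[OF haar, symmetric])
      (auto intro: Haar_likeD(3)[OF haar, unfolded infinity_ennreal_def])
  then obtain U where U: "open U" "p \<in> U" "emeasure \<mu> U < \<infinity>"
    unfolding INF_less_iff by blast
  then obtain e where e: "e > 0" "ball p e \<subseteq> U"
    using openE by blast
  then have "emeasure \<mu> (ball p e) < \<infinity>"
    using U by (intro order.strict_trans1[OF emeasure_mono U(3)]) (auto simp: sets)
  then have fin: "ennreal \<alpha> * emeasure \<mu> (ball p e) < \<infinity>"
    by (auto simp: ennreal_mult_less_top)
  \<comment> \<open>The summand 1 makes \<open>M\<close> positive.\<close>
  define M where "M = enn2real (ennreal \<alpha> * emeasure \<mu> (ball p e)) + 1"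
  have "ennreal \<alpha> * emeasure \<mu> (ball p e) \<le> ennreal M"
    using fin by (cases "ennreal \<alpha> * emeasure \<mu> (ball p e)") (auto simp: M_def intro: ennreal_leI)
  then have "emeasure \<mu> (ball q (e / L')) \<le> ennreal M" for q
    using L'(3)[of q "e / L'" p] L'(1) by simp
  moreover have "M > 0"
    by (simp add: M_def add_nonneg_pos)
  ultimately show thesis
    using that[of "e / L'" M] e(1) L'(1) by simp
qed

section \<open>Lower bound by the Assouad dimension\<close>

lemma sum_ennreal_const:
  fixes x :: real
  assumes "x \<ge> 0"
  shows "(\<Sum>s\<in>S. ennreal x) = ennreal (card S * x)"
  using assms by (subst sum_ennreal) auto

lemma Haar_like_lower_bound:
  fixes \<mu> :: "'a::metric_space measure"
  assumes doub: "doubling TYPE('a)" and hom: "biLipschitz_homogeneous L TYPE('a)"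
    and haar: "Haar_like \<mu>" and "t > 0"
  obtains c where "c > 0" "\<And>(p::'a) r. 0 < r \<Longrightarrow> r < 1 \<Longrightarrow>
    ennreal (c * r powr (enn2real (Assouad_dim TYPE('a)) + t)) \<le> emeasure \<mu> (ball p r)"
proof -
  define a where "a = enn2real (Assouad_dim TYPE('a))"
  obtain L' \<alpha> :: real where L': "L' > 1" "\<alpha> > 0"
    "\<And>p q r. emeasure \<mu> (ball p r) \<le> ennreal \<alpha> * emeasure \<mu> (ball q (L' * r))"
    using Haar_like_ball_le[OF hom haar] by blast
  note sets = Haar_likeD(1)[OF haar]
  have "Assouad_dim TYPE('a) = ennreal a"
    using Assouad_dim_finite[OF doub] by (simp add: a_def)
  \<comment> \<open>The slack \<open>t\<close> is spent here, on an admissible exponent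
    \<open>D \<le> a + t\<close>.\<close>
  also have "\<dots> < ennreal (a + t)"
    using \<open>t > 0\<close> by (intro ennreal_lessI) (auto simp: a_def add_nonneg_pos)
  finally obtain D C where D: "D > 0" "ennreal D < ennreal (a + t)" and "C \<ge> 1"
    and packing: "\<And>\<epsilon> (x::'a) r S. 0 < \<epsilon> \<Longrightarrow> \<epsilon> < 1 \<Longrightarrow> r > 0 \<Longrightarrow> S \<subseteq> ball x r \<Longrightarrow>
      pairwise (\<lambda>y z. dist y z \<ge> \<epsilon> * r) S \<Longrightarrow> finite S \<and> real (card S) \<le> C * \<epsilon> powr (- D)"
    by (rule Assouad_dim_lessE) (rule that, auto)
  have "D \<le> a + t"
    using D by (simp add: ennreal_less_iff)
  fix p0 :: 'a
  have "0 < emeasure \<mu> (ball p0 1)"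
    using Haar_like_ball_pos[OF hom haar] by simp
  \<comment> \<open>A positive real below the measure of the unit ball lets the estimate be solved
    among real numbers.\<close>
  then obtain b where b: "0 < ennreal b" "ennreal b < emeasure \<mu> (ball p0 1)"
    using ennreal_rat_dense by blast
  then have "b > 0" by (simp add: ennreal_less_zero_iff)
  \<comment> \<open>Obtained by solving
    \<open>b \<le> C * \<epsilon> powr (- D) * (\<alpha> * m)\<close> with
    \<open>\<epsilon> = r / L'\<close> for \<open>m\<close>, the measure of
    \<open>ball p r\<close>.\<close>
  define c where "c = b / (C * \<alpha> * L' powr D)"
  have "c > 0" using \<open>b > 0\<close> \<open>C \<ge> 1\<close> L' by (simp add: c_def)
  have "ennreal (c * r powr (a + t)) \<le> emeasure \<mu> (ball p r)" if r: "0 < r" "r < 1" for p r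
  proof (cases "emeasure \<mu> (ball p r)")
    case (real m)
    \<comment> \<open>With this radius, comparison bounds every ball of the net by \<alpha> times
      the measure of \<open>ball p r\<close> itself.\<close>
    define \<epsilon> where "\<epsilon> = r / L'"
    have \<epsilon>: "0 < \<epsilon>" "\<epsilon> < 1" "L' * \<epsilon> = r"
      using r L'(1) by (auto simp: \<epsilon>_def field_simps)
    obtain S where S: "S \<subseteq> ball p0 1" "pairwise (\<lambda>y z. dist y z \<ge> \<epsilon>) S"
        "ball p0 1 \<subseteq> (\<Union>s\<in>S. ball s \<epsilon>)"
      by (rule doubling_net[OF doub zero_less_one \<epsilon>(1)]) (rule that)
    have card: "finite S" "card S \<le> C * \<epsilon> powr (- D)"
      using packing[of \<epsilon> 1 S p0] S \<epsilon> by auto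
    have "ennreal b \<le> emeasure \<mu> (ball p0 1)"
      using b(2) by (rule less_imp_le)
    also have "\<dots> \<le> emeasure \<mu> (\<Union>s\<in>S. ball s \<epsilon>)"
      using S(3) by (intro emeasure_mono) (simp_all add: sets open_UN)
    also have "\<dots> \<le> (\<Sum>s\<in>S. emeasure \<mu> (ball s \<epsilon>))"
      using card(1) by (intro emeasure_subadditive_finite) (auto simp: sets)
    also have "\<dots> \<le> (\<Sum>s\<in>S. ennreal (\<alpha> * m))"
      using L'(3)[of _ \<epsilon> p] \<epsilon>(3) real L'(2) by (intro sum_mono) (simp add: ennreal_mult)
    also have "\<dots> = ennreal (card S * (\<alpha> * m))"
      using real L'(2) by (subst sum_ennreal_const) auto
    finally have "b \<le> card S * (\<alpha> * m)"
      using real L'(2) by simp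
    also have "\<dots> \<le> C * \<epsilon> powr (- D) * (\<alpha> * m)"
      using card(2) real L'(2) by (intro mult_right_mono) auto
    finally have "b * \<epsilon> powr D \<le> C * \<alpha> * m"
      using \<epsilon>(1) by (simp add: powr_minus field_simps)
    moreover have "\<epsilon> powr D = r powr D / L' powr D"
      using r L'(1) by (simp add: \<epsilon>_def powr_divide)
    ultimately have "c * r powr D \<le> m"
      using \<open>C \<ge> 1\<close> L' by (simp add: c_def field_simps)
    \<comment> \<open>Below radius 1 a larger exponent gives a smaller power.\<close>
    moreover have "c * r powr (a + t) \<le> c * r powr D"
      using \<open>c > 0\<close> r \<open>D \<le> a + t\<close> by (intro mult_left_mono powr_mono') auto
    ultimately show ?thesis
      using real by (simp add: ennreal_leI)
  qed simp
  then show thesis using that \<open>c > 0\<close> by (simp add: a_def)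
qed

section \<open>Upper bound by the Hausdorff dimension\<close>

text \<open>The contrapositive core of the upper bound. A ball of large relative mass is given at
  one centre only; comparison makes the balls of that scale heavy everywhere, so few disjoint ones
  fit into a ball of mass at most \<open>M\<close>.\<close>

lemma Hausdorff_null_of_large_balls:
  fixes \<mu> :: "'a::metric_space measure"
  assumes doub: "doubling TYPE('a)" and hom: "biLipschitz_homogeneous L TYPE('a)"
    and haar: "Haar_like \<mu>" and "s > 0"
    and "R > 0" and M: "M > 0" "\<And>q. emeasure \<mu> (ball q R) \<le> ennreal M"
    and large: "\<And>K. K > 0 \<Longrightarrow> \<exists>p r. 0 < r \<and> r < R \<and> ennreal (K * r powr s) < emeasure \<mu> (ball p r)"
  shows "Hausdorff_measure s (UNIV :: 'a set) = 0"
proof -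
  obtain L' \<alpha> :: real where L': "L' > 1" "\<alpha> > 0"
    "\<And>p q r. emeasure \<mu> (ball p r) \<le> ennreal \<alpha> * emeasure \<mu> (ball q (L' * r))"
    using Haar_like_ball_le[OF hom haar] by blast
  note sets = Haar_likeD(1)[OF haar]
  have null: "Hausdorff_measure s (ball q (R / 2)) = 0" for q :: 'a
  proof (rule Hausdorff_measure_eq_0I)
    fix \<delta> e :: real
    assume "\<delta> > 0" "e > 0"
    \<comment> \<open>The first bound keeps the diameters of the covering balls of radius
      \<open>2 * L' * r\<close> below \<delta>; the second keeps balls of radius
      \<open>L' * r\<close> centred in \<open>ball q (R / 2)\<close> inside
      \<open>ball q R\<close>.\<close>
    define \<rho> where "\<rho> = min (\<delta> / (4 * L')) (R / (2 * L'))"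
    have "\<rho> > 0" using \<open>\<delta> > 0\<close> \<open>R > 0\<close> L'(1) by (simp add: \<rho>_def)
    \<comment> \<open>The first term forces the scale \<open>r\<close> below \<open>\<rho>\<close>, the second makes the gauge sum at most \<open>e\<close>.\<close>
    define K where "K = max (M / \<rho> powr s) (M * \<alpha> * (4 * L') powr s / e)"
    have K: "M / \<rho> powr s \<le> K" "M * \<alpha> * (4 * L') powr s / e \<le> K"
      by (auto simp: K_def)
    have "M / \<rho> powr s > 0"
      using M(1) \<open>\<rho> > 0\<close> by simp
    then have "K > 0"
      using K(1) by linarith
    from large[OF this] obtain p r where
      r: "0 < r" "r < R" "ennreal (K * r powr s) < emeasure \<mu> (ball p r)"
      by blast
    have "emeasure \<mu> (ball p r) \<le> emeasure \<mu> (ball p R)"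
      using r by (intro emeasure_mono subset_ball) (auto simp: sets)
    with r(3) M(2)[of p] have "ennreal (K * r powr s) < ennreal M"
      by (meson order.strict_trans2)
    then have "K * r powr s < M"
      using \<open>K > 0\<close> by (simp add: ennreal_less_iff)
    also have "M \<le> K * \<rho> powr s"
      using K(1) \<open>\<rho> > 0\<close> by (simp add: field_simps)
    finally have "r powr s < \<rho> powr s"
      using \<open>K > 0\<close> by simp
    then have "r < \<rho>"
      using r \<open>\<rho> > 0\<close> \<open>s > 0\<close> by (meson not_le powr_mono2 less_imp_le)
    then have small: "4 * L' * r \<le> \<delta>" "L' * r \<le> R / 2"
      using L'(1) by (auto simp: \<rho>_def field_simps)
    have lower: "ennreal (K * r powr s / \<alpha>) \<le> emeasure \<mu> (ball x (L' * r))" for x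
    proof (cases "emeasure \<mu> (ball x (L' * r))")
      case (real m)
      have "ennreal (K * r powr s) \<le> ennreal \<alpha> * ennreal m"
        using r(3) L'(3)[of p r x] real by simp
      then have "K * r powr s \<le> \<alpha> * m"
        using real L'(2) by (simp add: ennreal_mult[symmetric])
      then show ?thesis
        using real L'(2) by (simp add: field_simps ennreal_leI)
    qed simp
    \<comment> \<open>One net serves twice: its separation makes the balls of radius
      \<open>L' * r\<close> disjoint, and balls of twice that radius cover.\<close>
    obtain S where S: "finite S" "S \<subseteq> ball q (R / 2)" "pairwise (\<lambda>y z. dist y z \<ge> 2 * L' * r) S"
        "ball q (R / 2) \<subseteq> (\<Union>x\<in>S. ball x (2 * L' * r))"
      using doubling_net[OF doub, of "R / 2" "2 * L' * r" q] \<open>R > 0\<close> r(1) L'(1) by auto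
    have disj: "disjoint_family_on (\<lambda>x. ball x (L' * r)) S"
      unfolding disjoint_family_on_def
    proof (intro ballI impI, rule ccontr)
      fix x y assume xy: "x \<in> S" "y \<in> S" "x \<noteq> y" "ball x (L' * r) \<inter> ball y (L' * r) \<noteq> {}"
      then obtain z where "dist x z < L' * r" "dist y z < L' * r" by auto
      then have "dist x y < 2 * L' * r"
        using dist_triangle2[of x y z] by simp
      then show False
        using pairwiseD[OF S(3) xy(1-3)] by simp
    qed
    have sub: "(\<Union>x\<in>S. ball x (L' * r)) \<subseteq> ball q R"
    proof
      fix z assume "z \<in> (\<Union>x\<in>S. ball x (L' * r))"
      then obtain x where "x \<in> S" "dist x z < L' * r" by auto
      then have "dist q x < R / 2" "dist x z < R / 2"
        using S(2) small(2) by auto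
      then show "z \<in> ball q R"
        using dist_triangle[of q z x] by simp
    qed
    have "ennreal (card S * (K * r powr s / \<alpha>)) = (\<Sum>x\<in>S. ennreal (K * r powr s / \<alpha>))"
      using \<open>K > 0\<close> L'(2) by (subst sum_ennreal_const) auto
    also have "\<dots> \<le> (\<Sum>x\<in>S. emeasure \<mu> (ball x (L' * r)))"
      by (intro sum_mono lower)
    also have "\<dots> = emeasure \<mu> (\<Union>x\<in>S. ball x (L' * r))"
      using disj S(1) by (intro sum_emeasure) (auto simp: sets)
    also have "\<dots> \<le> emeasure \<mu> (ball q R)"
      using sub by (intro emeasure_mono) (auto simp: sets)
    also have "\<dots> \<le> ennreal M"
      by (rule M(2))
    finally have "card S * (K * r powr s / \<alpha>) \<le> M"
      using M(1) by simp
    then have "K * (card S * r powr s) \<le> M * \<alpha>"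
      using L'(2) by (simp add: field_simps)
    \<comment> \<open>The factor \<open>(4 * L') powr s\<close> turns \<open>r powr s\<close> into
      the bound for the gauge of one covering ball.\<close>
    then have "K * (card S * r powr s) * (4 * L') powr s \<le> M * \<alpha> * (4 * L') powr s"
      by (intro mult_right_mono) auto
    also have "\<dots> \<le> K * e"
      using K(2) \<open>e > 0\<close> by (simp add: field_simps)
    finally have "K * (card S * (4 * L' * r) powr s) \<le> K * e"
      using L'(1) r(1) by (simp add: powr_mult mult_ac)
    then have card: "card S * (4 * L' * r) powr s \<le> e"
      using \<open>K > 0\<close> by simp
    have diam: "diameter (ball x (2 * L' * r)) \<le> 4 * L' * r" for x :: 'a
      using diameter_ball_le[of "2 * L' * r" x] L'(1) r(1) by simp
    have "Hausdorff_premeasure s \<delta> (ball q (R / 2)) \<le>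
        (\<Sum>x\<in>S. Hausdorff_gauge s (ball x (2 * L' * r)))"
      using S(1,4) \<open>\<delta> > 0\<close> order_trans[OF diam small(1)]
      by (intro Hausdorff_premeasure_le_finite_cover) auto
    also have "\<dots> \<le> (\<Sum>x\<in>S. ennreal ((4 * L' * r) powr s))"
      using \<open>s > 0\<close> diam
      by (intro sum_mono)
        (auto simp: Hausdorff_gauge_def intro!: ennreal_leI powr_mono2 diameter_ge_0)
    also have "\<dots> = ennreal (card S * (4 * L' * r) powr s)"
      by (subst sum_ennreal_const) auto
    also have "\<dots> \<le> ennreal e"
      using card by (rule ennreal_leI)
    finally show "Hausdorff_premeasure s \<delta> (ball q (R / 2)) \<le> ennreal e" .
  qed
  obtain q :: "nat \<Rightarrow> 'a" where "(\<Union>i. ball (q i) (R / 2)) = UNIV"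
    using doubling_countable_net[OF doub, of "R / 2"] \<open>R > 0\<close> by auto
  then show ?thesis
    using Hausdorff_measure_UN_null[OF null, of q] by simp
qed

lemma Haar_like_upper_bound:
  fixes \<mu> :: "'a::metric_space measure"
  assumes doub: "doubling TYPE('a)" and hom: "biLipschitz_homogeneous L TYPE('a)"
    and haar: "Haar_like \<mu>" and "t > 0"
  obtains R K where "R > 0" "K > 0" "\<And>(p::'a) r. 0 < r \<Longrightarrow> r < R \<Longrightarrow>
    emeasure \<mu> (ball p r) \<le> ennreal (K * r powr (enn2real (Hausdorff_dim (UNIV :: 'a set)) - t))"
proof -
  define s where "s = enn2real (Hausdorff_dim (UNIV :: 'a set)) - t"
  obtain R M where R: "R > 0" and M: "M > 0" "\<And>q. emeasure \<mu> (ball q R) \<le> ennreal M"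
    using Haar_like_ball_bounded[OF hom haar] by blast
  note sets = Haar_likeD(1)[OF haar]
  show thesis
  proof (cases "s > 0")
    case True
    \<comment> \<open>Otherwise the dimension would be at most \<open>s\<close>, which is smaller by
      \<open>t\<close>.\<close>
    have "Hausdorff_measure s (UNIV :: 'a set) \<noteq> 0"
    proof
      assume "Hausdorff_measure s (UNIV :: 'a set) = 0"
      then have "Hausdorff_dim (UNIV :: 'a set) \<le> ennreal s"
        unfolding Hausdorff_dim_def using True by (intro Inf_lower) force
      then have "enn2real (Hausdorff_dim (UNIV :: 'a set)) \<le> s"
        using True by (intro enn2real_leI) auto
      then show False
        using \<open>t > 0\<close> by (simp add: s_def)
    qed
    then obtain K where "K > 0"
      "\<not> (\<exists>p r. 0 < r \<and> r < R \<and> ennreal (K * r powr s) < emeasure \<mu> (ball p r))"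
      using Hausdorff_null_of_large_balls[OF doub hom haar True R M] by blast
    then show thesis
      using that[OF R \<open>K > 0\<close>] unfolding s_def by (meson not_le)
  next
    case False
    \<comment> \<open>For \<open>s \<le> 0\<close> and \<open>r < 1\<close> the power is at least 1,
      so the uniform bound \<open>M\<close> suffices.\<close>
    have "emeasure \<mu> (ball p r) \<le> ennreal (M * r powr s)" if r: "0 < r" "r < min R 1" for p r
    proof -
      have "1 \<le> r powr s"
        using powr_mono'[of s 0 r] False r by simp
      then have "M \<le> M * r powr s"
        using M(1) by simp
      moreover have "emeasure \<mu> (ball p r) \<le> emeasure \<mu> (ball p R)"
        using r by (intro emeasure_mono subset_ball) (auto simp: sets)
      ultimately show ?thesis
        using M(2)[of p] by (meson ennreal_leI order_trans)
    qed
    then show thesis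
      using that[of "min R 1" M] R M(1) by (simp add: s_def)
  qed
qed

section \<open>Combination of the two bounds\<close>

theorem corollary4p13:
  fixes \<mu> :: "'a::metric_space measure" and L :: real
  assumes "doubling TYPE('a)"
    and "biLipschitz_homogeneous L TYPE('a)"
    and "Haar_like \<mu>"
  shows "\<forall>t>0. \<exists>r\<^sub>0>0. \<exists>K>1. \<forall>(p::'a) r. 0 < r \<and> r < r\<^sub>0 \<longrightarrow>
    ennreal (1 / K * r powr (enn2real (Assouad_dim TYPE('a)) + t)) < emeasure \<mu> (ball p r) \<and>
    emeasure \<mu> (ball p r) < ennreal (K * r powr (enn2real (Hausdorff_dim (UNIV :: 'a set)) - t))"
proof (intro allI impI)
  fix t :: real
  assume "t > 0"
  obtain c where c: "c > 0" "\<And>(p::'a) r. 0 < r \<Longrightarrow> r < 1 \<Longrightarrow>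
      ennreal (c * r powr (enn2real (Assouad_dim TYPE('a)) + t)) \<le> emeasure \<mu> (ball p r)"
    using Haar_like_lower_bound[OF assms \<open>t > 0\<close>] by blast
  obtain R K where K: "R > 0" "K > 0" "\<And>(p::'a) r. 0 < r \<Longrightarrow> r < R \<Longrightarrow>
      emeasure \<mu> (ball p r) \<le> ennreal (K * r powr (enn2real (Hausdorff_dim (UNIV :: 'a set)) - t))"
    using Haar_like_upper_bound[OF assms \<open>t > 0\<close>] by blast
  \<comment> \<open>Strictly larger than 1, \<open>1 / c\<close> and \<open>K\<close>, which turns
    both weak bounds into strict ones.\<close>
  define K' where "K' = 1 + 1 / c + K"
  have "1 / c > 0" using c(1) by simp
  then have "K' > 1" "K < K'" "1 / c < K'"
    using K(2) unfolding K'_def by linarith+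
  then have "1 / K' < c"
    using c(1) by (simp add: field_simps)
  have "ennreal (1 / K' * r powr (enn2real (Assouad_dim TYPE('a)) + t)) < emeasure \<mu> (ball p r) \<and>
      emeasure \<mu> (ball p r) < ennreal (K' * r powr (enn2real (Hausdorff_dim (UNIV :: 'a set)) - t))"
    if r: "0 < r" "r < min R 1" for p :: 'a and r
  proof
    have "ennreal (1 / K' * r powr (enn2real (Assouad_dim TYPE('a)) + t))
        < ennreal (c * r powr (enn2real (Assouad_dim TYPE('a)) + t))"
      using \<open>1 / K' < c\<close> c(1) r(1) by (intro ennreal_lessI mult_strict_right_mono mult_pos_pos) auto
    also have "\<dots> \<le> emeasure \<mu> (ball p r)"
      using c(2) r by simp
    finally show "ennreal (1 / K' * r powr (enn2real (Assouad_dim TYPE('a)) + t)) < emeasure \<mu> (ball p r)" .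
    have "emeasure \<mu> (ball p r) \<le> ennreal (K * r powr (enn2real (Hausdorff_dim (UNIV :: 'a set)) - t))"
      using K(3) r by simp
    also have "\<dots> < ennreal (K' * r powr (enn2real (Hausdorff_dim (UNIV :: 'a set)) - t))"
      using \<open>K < K'\<close> K(2) r(1) by (intro ennreal_lessI mult_strict_right_mono mult_pos_pos) auto
    finally show "emeasure \<mu> (ball p r) < ennreal (K' * r powr (enn2real (Hausdorff_dim (UNIV :: 'a set)) - t))" .
  qed
  then show "\<exists>r\<^sub>0>0. \<exists>K>1. \<forall>(p::'a) r. 0 < r \<and> r < r\<^sub>0 \<longrightarrow>
      ennreal (1 / K * r powr (enn2real (Assouad_dim TYPE('a)) + t)) < emeasure \<mu> (ball p r) \<and>
      emeasure \<mu> (ball p r) < ennreal (K * r powr (enn2real (Hausdorff_dim (UNIV :: 'a set)) - t))"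
    using K(1) \<open>K' > 1\<close> by (intro exI[of _ "min R 1"] conjI exI[of _ K']) auto
qed

end
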